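(* Let $f:\mathbb{R}^n\to\mathbb{R}$ be continuously differentiable, $L$-smooth and $\mu$-strongly convex, let $\kappa=\frac L\mu$, and let $x^*=\arg\min_{z\in\mathbb{R}^n}f(z)$. Consider the ACCONEST flow $$\begin{bmatrix}\dot{\bar x}_1\\\dot{\bar x}_2\end{bmatrix}=F_{\mathrm{Acc}}(\bar x_1,\bar x_2)=\begin{bmatrix}\bar x_2-\bar x_1-\frac1L\nabla f(\bar x_2)\\[2pt]\frac{\sqrt\kappa-1}{\sqrt\kappa+1}(\bar x_2-\bar x_1)-\frac{2\sqrt\kappa}{(\sqrt\kappa+1)L}\nabla f(\bar x_2)\end{bmatrix},\qquad\bar x_1,\bar x_2\in\mathbb{R}^n.$$ Let $((y_k^{(1)},y_k^{(2)}))_{k\ge0}$ be the sequence generated by its explicit Euler discretization with integration step-size $1$, i.e. $(y_{k+1}^{(1)},y_{k+1}^{(2)})=(y_k^{(1)},y_k^{(2)})+F_{\mathrm{Acc}}(y_k^{(1)},y_k^{(2)})$. Then there is linear convergence to the optimal value: $$f(y_k^{(1)})-f(x^* )\le C\Big(1-\sqrt{\tfrac\mu L}\Big)^k,$$ with $C$ some constant (not depending on $k$) that depends on the initial conditions $y_0^{(1)},y_0^{(2)}\in\mathbb{R}^n$.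
   Context: A continuously differentiable $f$ is $L$-smooth ($L>0$) if $\|\nabla f(x)-\nabla f(y)\|_2\le L\|x-y\|_2$ for all $x,y$, and $\mu$-strongly convex ($\mu>0$) if $\mu\|x-y\|_2^2\le(\nabla f(x)-\nabla f(y))^\top(x-y)$ for all $x,y$. *)

theory Defs
  imports "HOL-Analysis.Analysis"
begin

definition gradient :: "('a::real_inner \<Rightarrow> real) \<Rightarrow> 'a \<Rightarrow> 'a" where
  "gradient f x = (THE D. GDERIV f x :> D)"

lemma gradient_eqI: "GDERIV f x :> D \<Longrightarrow> gradient f x = D"
proof -
  assume D: "GDERIV f x :> D"
  have "E = D" if "GDERIV f x :> E" for E
  proof -
    have "(\<lambda>h. h \<bullet> E) = (\<lambda>h. h \<bullet> D)"
      using that D has_derivative_unique unfolding gderiv_def by blast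
    then have "(E - D) \<bullet> (E - D) = 0"
      by (metis inner_diff_right right_minus_eq)
    then show "E = D" by simp
  qed
  with D show ?thesis unfolding gradient_def by (rule the_equality)
qed

definition continuously_differentiable :: "('a::real_inner \<Rightarrow> real) \<Rightarrow> bool" where
  "continuously_differentiable f \<longleftrightarrow>
     (\<forall>x. f differentiable (at x)) \<and> continuous_on UNIV (gradient f)"

definition smooth_with :: "real \<Rightarrow> ('a::real_inner \<Rightarrow> real) \<Rightarrow> bool" where
  "smooth_with L f \<longleftrightarrow>
     L > 0 \<and> (\<forall>x y. norm (gradient f x - gradient f y) \<le> L * norm (x - y))"

definition strongly_convex_with :: "real \<Rightarrow> ('a::real_inner \<Rightarrow> real) \<Rightarrow> bool" where
  "strongly_convex_with \<mu> f \<longleftrightarrow>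
     \<mu> > 0 \<and> (\<forall>x y. \<mu> * (norm (x - y))\<^sup>2 \<le> (gradient f x - gradient f y) \<bullet> (x - y))"

definition acconest_field ::
  "real \<Rightarrow> real \<Rightarrow> ('a::real_inner \<Rightarrow> real) \<Rightarrow> 'a \<times> 'a \<Rightarrow> 'a \<times> 'a" where
  "acconest_field L \<kappa> f = (\<lambda>(x1, x2).
     (x2 - x1 - (1 / L) *\<^sub>R gradient f x2,
      ((sqrt \<kappa> - 1) / (sqrt \<kappa> + 1)) *\<^sub>R (x2 - x1)
        - (2 * sqrt \<kappa> / ((sqrt \<kappa> + 1) * L)) *\<^sub>R gradient f x2))"

definition explicit_euler :: "real \<Rightarrow> ('b::real_vector \<Rightarrow> 'b) \<Rightarrow> (nat \<Rightarrow> 'b) \<Rightarrow> bool" where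
  "explicit_euler h F y \<longleftrightarrow> (\<forall>k. y (Suc k) = y k + h *\<^sub>R F (y k))"

end

theory Submission
  imports Defs
begin

text \<open>One Euler step of the flow is a step of Nesterov's method
  \<open>y\<^sup>+ = x - \<nabla>f(x)/L\<close>, \<open>x\<^sup>+ = y\<^sup>+ + \<beta>(y\<^sup>+ - y)\<close> with \<open>\<beta> = (\<surd>\<kappa> - 1)/(\<surd>\<kappa> + 1)\<close>,
  where \<open>y\<close> and \<open>x\<close> are the first and second components.
  Put \<open>\<alpha> = 1/\<surd>\<kappa>\<close> and \<open>v = x + (x - y)/\<alpha>\<close>. Then \<open>v\<^sup>+ = (1-\<alpha>)v + \<alpha>x - (\<alpha>/\<mu>)\<nabla>f(x)\<close>, and for every
  point \<open>z\<close> the energy \<open>f(y) - f(z) + \<mu>/2 \<parallel>v - z\<parallel>\<^sup>2\<close> shrinks by the factor \<open>1 - \<alpha>\<close> in each step: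
  the descent lemma at \<open>x\<close> absorbs the \<open>\<parallel>\<nabla>f(x)\<parallel>\<^sup>2\<close> term, and the strong convexity bound from \<open>x\<close>
  to \<open>z\<close> and the convexity bound from \<open>x\<close> to \<open>y\<close> absorb the rest.\<close>

text \<open>Riesz representation: the derivative is a linear functional, hence the inner product
  with the image of 1 under its adjoint.\<close>

lemma GDERIV_gradient:
  fixes f :: "'a::euclidean_space \<Rightarrow> real"
  assumes "f differentiable (at x)"
  shows "GDERIV f x :> gradient f x"
proof -
  obtain f' where f': "(f has_derivative f') (at x)"
    using assms unfolding differentiable_def by blast
  then have "linear f'"
    by (rule has_derivative_linear)
  then have "f' h = h \<bullet> adjoint f' 1" for h
    using adjoint_works[of f' h 1] by simp
  then have "GDERIV f x :> adjoint f' 1"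
    using f' unfolding gderiv_def by (metis ext)
  then show ?thesis
    using gradient_eqI by metis
qed

text \<open>Subtracting the linear and quadratic terms from \<open>f\<close> along the segment from
  \<open>x\<close> to \<open>z\<close> leaves a function with nonnegative derivative. The sign of
  \<open>c\<close> is left free, so that \<open>c = \<mu>\<close> gives strong convexity and
  \<open>c = - L\<close> the descent lemma.\<close>

lemma quadratic_lower_bound:
  fixes f :: "'a::real_inner \<Rightarrow> real"
  assumes G: "\<And>u. GDERIV f u :> g u"
    and mono: "\<And>u w. c * (norm (u - w))\<^sup>2 \<le> (g u - g w) \<bullet> (u - w)"
  shows "f x + g x \<bullet> (z - x) + c / 2 * (norm (z - x))\<^sup>2 \<le> f z"
proof -
  define d where "d = z - x"
  define \<phi> where "\<phi> t = f (x + t *\<^sub>R d) - t * (g x \<bullet> d) - c / 2 * t\<^sup>2 * (norm d)\<^sup>2" for t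
  define \<phi>' where "\<phi>' t = (g (x + t *\<^sub>R d) - g x) \<bullet> d - c * t * (norm d)\<^sup>2" for t
  have D: "(\<phi> has_real_derivative \<phi>' t) (at t)" for t
  proof -
    have "((\<lambda>t. x + t *\<^sub>R d) has_derivative (\<lambda>s. s *\<^sub>R d)) (at t)"
      by (auto intro!: derivative_eq_intros)
    moreover have "(f has_derivative (\<lambda>h. h \<bullet> g (x + t *\<^sub>R d))) (at (x + t *\<^sub>R d))"
      using G unfolding gderiv_def .
    ultimately have "((\<lambda>t. f (x + t *\<^sub>R d)) has_derivative (\<lambda>s. (s *\<^sub>R d) \<bullet> g (x + t *\<^sub>R d))) (at t)"
      by (rule has_derivative_compose)
    then have "((\<lambda>t. f (x + t *\<^sub>R d)) has_real_derivative (g (x + t *\<^sub>R d) \<bullet> d)) (at t)"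
      by (rule has_derivative_imp_has_field_derivative) (simp add: inner_commute)
    then show ?thesis
      unfolding \<phi>_def \<phi>'_def
      by (auto intro!: derivative_eq_intros simp: inner_diff_left)
  qed
  have pos: "0 \<le> \<phi>' t" if "0 \<le> t" for t
  proof (cases "t = 0")
    case False
    with that have "t > 0" by simp
    \<comment> \<open>Monotonicity between the two points on the segment controls t \<phi>'(t); the
      factor t is then divided out.\<close>
    have "c * (norm (t *\<^sub>R d))\<^sup>2 \<le> (g (x + t *\<^sub>R d) - g x) \<bullet> (t *\<^sub>R d)"
      using mono[of "x + t *\<^sub>R d" x] by simp
    then have "0 \<le> t * \<phi>' t"
      by (simp add: \<phi>'_def power_mult_distrib algebra_simps power2_eq_square)
    with \<open>t > 0\<close> show ?thesis
      by (simp add: zero_le_mult_iff)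
  qed (simp add: \<phi>'_def)
  have "\<phi> 0 \<le> \<phi> 1"
    by (rule DERIV_nonneg_imp_nondecreasing) (use D pos in auto)
  then show ?thesis
    by (simp add: \<phi>_def d_def)
qed

text \<open>By Cauchy-Schwarz, \<open>- g\<close> satisfies the monotonicity bound with constant
  \<open>- L\<close>, so the lower bound applies to \<open>- f\<close>.\<close>

lemma descent_lemma:
  fixes f :: "'a::real_inner \<Rightarrow> real"
  assumes G: "\<And>u. GDERIV f u :> g u"
    and lip: "\<And>u w. norm (g u - g w) \<le> L * norm (u - w)"
  shows "f z \<le> f x + g x \<bullet> (z - x) + L / 2 * (norm (z - x))\<^sup>2"
proof -
  have "GDERIV (\<lambda>u. - f u) u :> - g u" for u
    using G by (rule GDERIV_minus)
  moreover have "- L * (norm (u - w))\<^sup>2 \<le> (- g u - - g w) \<bullet> (u - w)" for u w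
  proof -
    have "(g u - g w) \<bullet> (u - w) \<le> norm (g u - g w) * norm (u - w)"
      by (rule norm_cauchy_schwarz)
    also have "\<dots> \<le> L * norm (u - w) * norm (u - w)"
      using lip by (rule mult_right_mono) simp
    finally show ?thesis
      by (simp add: power2_eq_square inner_diff_left)
  qed
  ultimately have "- f x + - g x \<bullet> (z - x) + - L / 2 * (norm (z - x))\<^sup>2 \<le> - f z"
    by (rule quadratic_lower_bound)
  then show ?thesis by simp
qed

lemma acconest_energy_step:
  fixes f :: "'a::real_inner \<Rightarrow> real"
  assumes G: "\<And>u. GDERIV f u :> g u"
    and lip: "\<And>u w. norm (g u - g w) \<le> L * norm (u - w)"
    and mono: "\<And>u w. \<mu> * (norm (u - w))\<^sup>2 \<le> (g u - g w) \<bullet> (u - w)"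
    and pos: "0 < \<mu>" "0 < L" "0 < \<alpha>" "\<alpha> \<le> 1" and \<alpha>: "\<mu> = \<alpha>\<^sup>2 * L"
    and y': "y' = x - (1 / L) *\<^sub>R g x"
    and v: "v = x + (1 / \<alpha>) *\<^sub>R (x - y)"
    and v': "v' = y + (1 / \<alpha>) *\<^sub>R (y' - y)"
  shows "f y' - f z + \<mu> / 2 * (norm (v' - z))\<^sup>2
    \<le> (1 - \<alpha>) * (f y - f z + \<mu> / 2 * (norm (v - z))\<^sup>2)"
proof -
  define a where "a = x - z"
  define w where "w = x - y"
  define p where "p = g x"
  have descent: "f y' \<le> f x - (p \<bullet> p) / (2 * L)"
    using descent_lemma[OF G lip, of y' x] \<open>0 < L\<close>
    by (simp add: y' p_def power_divide dot_square_norm field_simps power2_eq_square)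
  have to_z: "f x - p \<bullet> a + \<mu> / 2 * (a \<bullet> a) \<le> f z"
    using quadratic_lower_bound[OF G mono, of x z]
    by (simp add: p_def a_def power2_norm_eq_inner inner_diff_right inner_diff_left inner_commute algebra_simps)
  \<comment> \<open>Towards \<open>y\<close> the quadratic term is dropped, leaving plain
    convexity.\<close>
  have "0 \<le> \<mu> / 2 * (norm (y - x))\<^sup>2"
    using pos by simp
  then have to_y: "f x - p \<bullet> w \<le> f y"
    using quadratic_lower_bound[OF G mono, of x y]
    by (simp add: p_def w_def inner_diff_right)
  have vz: "v - z = a + (1 / \<alpha>) *\<^sub>R w"
    by (simp add: v a_def w_def)
  have v'z: "v' - z = a + ((1 - \<alpha>) / \<alpha>) *\<^sub>R w - (1 / (\<alpha> * L)) *\<^sub>R p"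
  proof -
    have "((1 - \<alpha>) / \<alpha>) *\<^sub>R w = (1 / \<alpha>) *\<^sub>R w - w"
      using pos by (simp add: diff_divide_distrib scaleR_diff_left)
    then show ?thesis
      by (simp add: v' y' a_def w_def p_def algebra_simps)
  qed
  \<comment> \<open>Expanding the square, \<open>\<mu> = \<alpha>\<^sup>2 * L\<close> turns the
    coefficient of \<open>p \<bullet> p\<close> into exactly the gain in \<open>descent\<close>. The
    terms in \<open>p \<bullet> a\<close> and \<open>p \<bullet> w\<close> match \<open>to_z\<close>
    and \<open>to_y\<close> with weights \<alpha> and 1 - \<alpha>.\<close>
  have energy: "\<mu> / 2 * (norm (v' - z))\<^sup>2 = (1 - \<alpha>) * (\<mu> / 2 * (norm (v - z))\<^sup>2)
      + \<alpha> * (\<mu> / 2) * (a \<bullet> a) - L * \<alpha> * (1 - \<alpha>) / 2 * (w \<bullet> w)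
      - \<alpha> * (p \<bullet> a) - (1 - \<alpha>) * (p \<bullet> w) + (p \<bullet> p) / (2 * L)"
    unfolding vz v'z \<alpha> power2_norm_eq_inner using pos
    by (simp add: inner_add_left inner_add_right inner_diff_left inner_diff_right
        inner_commute field_simps power2_eq_square)
  have "0 \<le> L * \<alpha> * (1 - \<alpha>) / 2 * (w \<bullet> w)"
    using pos by simp
  moreover have "\<alpha> * (f x - p \<bullet> a + \<mu> / 2 * (a \<bullet> a)) \<le> \<alpha> * f z"
    using to_z pos by (simp add: mult_left_mono)
  moreover have "(1 - \<alpha>) * (f x - p \<bullet> w) \<le> (1 - \<alpha>) * f y"
    using to_y pos by (simp add: mult_left_mono)
  ultimately show ?thesis
    using descent energy by (simp add: algebra_simps diff_divide_distrib)
qed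

text \<open>Both bounds are compared on a pair of points at distance 1. This ensures \<alpha> \<le>
  1, so the contraction factor is nonnegative.\<close>

lemma strong_convexity_le_smoothness:
  fixes f :: "'a::euclidean_space \<Rightarrow> real"
  assumes "smooth_with L f" and "strongly_convex_with \<mu> f"
  shows "\<mu> \<le> L"
proof -
  obtain b :: 'a where b: "norm b = 1"
    using vector_choose_size[of 1] by auto
  have "\<mu> * (norm (b - 0))\<^sup>2 \<le> (gradient f b - gradient f 0) \<bullet> (b - 0)"
    using assms(2) unfolding strongly_convex_with_def by blast
  also have "\<dots> \<le> norm (gradient f b - gradient f 0) * norm (b - 0)"
    by (rule norm_cauchy_schwarz)
  also have "\<dots> \<le> (L * norm (b - 0)) * norm (b - 0)"
    using assms(1) unfolding smooth_with_def by (blast intro: mult_right_mono norm_ge_zero)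
  finally show ?thesis
    using b by simp
qed

theorem proposition4p4:
  fixes f :: "real ^ 'n \<Rightarrow> real"
    and L \<mu> \<kappa> :: real
    and xstar :: "real ^ 'n"
    and y :: "nat \<Rightarrow> (real ^ 'n) \<times> (real ^ 'n)"
  assumes "continuously_differentiable f"
    and "smooth_with L f"
    and "strongly_convex_with \<mu> f"
    and "\<kappa> = L / \<mu>"
    and "xstar = (ARG_MIN f z. True)"
    and "explicit_euler 1 (acconest_field L \<kappa> f) y"
  shows "\<exists>C::real. \<forall>k. f (fst (y k)) - f xstar \<le> C * (1 - sqrt (\<mu> / L)) ^ k"
proof -
  define \<alpha> where "\<alpha> = sqrt (\<mu> / L)"
  have pos: "0 < \<mu>" "0 < L"
    using assms(2,3) unfolding smooth_with_def strongly_convex_with_def by auto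
  have "\<mu> \<le> L"
    using assms(2,3) by (rule strong_convexity_le_smoothness)
  with pos have \<alpha>: "0 < \<alpha>" "\<alpha> \<le> 1" "\<mu> = \<alpha>\<^sup>2 * L"
    by (auto simp: \<alpha>_def)
  have \<kappa>: "sqrt \<kappa> = 1 / \<alpha>"
    unfolding assms(4) \<alpha>_def by (simp add: real_sqrt_divide)
  define Y X where "Y k = fst (y k)" and "X k = snd (y k)" for k
  define v where "v k = X k + (1 / \<alpha>) *\<^sub>R (X k - Y k)" for k
  define E where "E k = f (Y k) - f xstar + \<mu> / 2 * (norm (v k - xstar))\<^sup>2" for k
  have step: "y (Suc k) = y k + acconest_field L \<kappa> f (y k)" for k
    using assms(6) unfolding explicit_euler_def by simp
  have Y_step: "Y (Suc k) = X k - (1 / L) *\<^sub>R gradient f (X k)" for k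
    using step[of k] by (simp add: Y_def X_def acconest_field_def split_beta)
  have X_step: "X (Suc k) = Y (Suc k) + ((1 - \<alpha>) / (1 + \<alpha>)) *\<^sub>R (Y (Suc k) - Y k)" for k
  proof -
    define \<beta> where "\<beta> = (1 - \<alpha>) / (1 + \<alpha>)"
    have "(sqrt \<kappa> - 1) / (sqrt \<kappa> + 1) = \<beta>"
      unfolding \<kappa> \<beta>_def using \<alpha>(1) by (simp add: divide_simps)
    moreover have "2 * sqrt \<kappa> / ((sqrt \<kappa> + 1) * L) = (1 + \<beta>) / L"
      unfolding \<kappa> \<beta>_def using \<alpha>(1) pos by (simp add: divide_simps)
    ultimately have "X (Suc k) = X k + (\<beta> *\<^sub>R (X k - Y k) - ((1 + \<beta>) / L) *\<^sub>R gradient f (X k))"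
      using step[of k] by (simp add: Y_def X_def acconest_field_def split_beta)
    then show ?thesis
      unfolding Y_step \<beta>_def[symmetric] by (simp add: algebra_simps add_divide_distrib)
  qed
  have v_step: "v (Suc k) = Y k + (1 / \<alpha>) *\<^sub>R (Y (Suc k) - Y k)" for k
  proof -
    define D where "D = Y (Suc k) - Y k"
    have "v (Suc k) = Y k + (1 + (1 - \<alpha>) / (1 + \<alpha>) + 1 / \<alpha> * ((1 - \<alpha>) / (1 + \<alpha>))) *\<^sub>R D"
      unfolding v_def X_step D_def[symmetric] by (simp add: D_def algebra_simps)
    \<comment> \<open>With \<beta> = (1 - \<alpha>)/(1 + \<alpha>), the sum is 1 + \<beta>(1 +
      \<alpha>)/\<alpha> = 1 + (1 - \<alpha>)/\<alpha>.\<close>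
    also have "1 + (1 - \<alpha>) / (1 + \<alpha>) + 1 / \<alpha> * ((1 - \<alpha>) / (1 + \<alpha>)) = 1 / \<alpha>"
      using \<alpha>(1) by (simp add: divide_simps)
    finally show ?thesis unfolding D_def .
  qed
  have G: "GDERIV f u :> gradient f u" for u
    using assms(1) unfolding continuously_differentiable_def by (blast intro: GDERIV_gradient)
  have lip: "norm (gradient f u - gradient f w) \<le> L * norm (u - w)" for u w
    using assms(2) unfolding smooth_with_def by blast
  have mono: "\<mu> * (norm (u - w))\<^sup>2 \<le> (gradient f u - gradient f w) \<bullet> (u - w)" for u w
    using assms(3) unfolding strongly_convex_with_def by blast
  have E_step: "E (Suc k) \<le> (1 - \<alpha>) * E k" for k
    unfolding E_def
    by (rule acconest_energy_step[OF G lip mono pos \<alpha> Y_step v_def v_step])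
  \<comment> \<open>The constant is the initial energy; the squared norm in \<open>E k\<close> is
    nonnegative, so \<open>E k\<close> dominates the gap in value.\<close>
  have "f (Y k) - f xstar \<le> E 0 * (1 - \<alpha>) ^ k" for k
  proof -
    have "E k \<le> E 0 * (1 - \<alpha>) ^ k"
    proof (induction k)
      case (Suc k)
      have "(1 - \<alpha>) * E k \<le> (1 - \<alpha>) * (E 0 * (1 - \<alpha>) ^ k)"
        using Suc \<alpha> by (intro mult_left_mono) auto
      with E_step[of k] show ?case
        by (simp add: mult_ac)
    qed simp
    moreover have "f (Y k) - f xstar \<le> E k"
      unfolding E_def using pos by simp
    ultimately show ?thesis by linarith
  qed
  then show ?thesis
    unfolding Y_def \<alpha>_def by blast
qed

end
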